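(* For every integer $n\geq 0$, (i) $\displaystyle Q_2(n) = \sum_{j=0}^\infty \rho_j\, p\big(n-j(j+1)\big)$; (ii) $\displaystyle Q_2(n) = \sum_{j=-\infty}^{\infty} p\left(\frac{n-j(3j-2)}{3}\right)$, where $p(x)=0$ when $x$ is not a nonnegative integer.
   Context: $p(n)$ denotes the number of partitions of $n$ (with $p(0)=1$). $Q_2(n)$ denotes the number of partitions of $n$ into distinct parts which are not congruent to $\pm 2$ modulo $6$ (with $Q_2(0)=1$). For any integer $k$, $\rho_k:=-2$ if $k\equiv 1\pmod 3$, and $\rho_k:=1$ otherwise. *)

theory Defs
  imports
    "HOL-Analysis.Infinite_Sum"
    "HOL-Library.Multiset"
    "HOL-Number_Theory.Cong"
begin

definition partitions :: "nat \<Rightarrow> nat multiset set" where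
  "partitions n = {M. 0 \<notin># M \<and> sum_mset M = n}"

definition num_partitions :: "nat \<Rightarrow> nat" where
  "num_partitions n = card (partitions n)"

text \<open>
  The partition function on all real arguments, with the convention that it vanishes unless the argument is a nonnegative integer (the set \<open>\<nat>\<close> contains 0).
\<close>
definition p :: "real \<Rightarrow> nat" where
  "p x = (if x \<in> \<nat> then num_partitions (nat \<lfloor>x\<rfloor>) else 0)"

definition Q\<^sub>2 :: "nat \<Rightarrow> nat" where
  "Q\<^sub>2 n = card {M \<in> partitions n.
      (\<forall>k. count M k \<le> 1) \<and>
      (\<forall>k\<in>#M. \<not> [int k = 2] (mod 6) \<and> \<not> [int k = - 2] (mod 6))}"

definition \<rho> :: "int \<Rightarrow> int" where
  "\<rho> k = (if [k = 1] (mod 3) then - 2 else 1)"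

end

theory Submission
  imports Defs "HOL-Computational_Algebra.Formal_Power_Series"
begin

text \<open>
  Both identities are instances of the Jacobi triple product
  \<open>(-a; ab)\<^sub>\<infinity> (-b; ab)\<^sub>\<infinity> (ab; ab)\<^sub>\<infinity> = (\<Sum>j\<in>\<int>. a ^ (j(j+1)/2) * b ^ (j(j-1)/2))\<close>.
  For (ii) take \<open>a = q\<close>, \<open>b = q^5\<close>: after division by \<open>(q^3; q^3)\<^sub>\<infinity>\<close> the product becomes the
  generating function of \<open>Q\<^sub>2\<close>, because the remaining factor is
  \<open>(q^6; q^6)\<^sub>\<infinity> / (q^3; q^3)\<^sub>\<infinity> = (-q^3; q^3)\<^sub>\<infinity>\<close>.
  For (i) take \<open>a = \<omega> q^2\<close>, \<open>b = \<omega>^2\<close> with a primitive cube root of unity \<open>\<omega>\<close>; pairing \<open>j\<close> with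
  \<open>-1-j\<close> turns the powers of \<open>\<omega>\<close> into \<open>(1 + \<omega>^2) \<rho>\<^sub>j\<close>, and
  \<open>(1+x)(1+\<omega>x)(1+\<omega>^2x) = 1+x^3\<close> simplifies the product.
  Infinite products are avoided: the triple product is a limit of a finite form with Gaussian
  binomial coefficients, and all identities are read modulo \<open>q^N\<close>.
\<close>

section \<open>A finite form of the Jacobi triple product\<close>

text \<open>The q-Pochhammer symbol (x; x)_n.\<close>

definition qfac :: "'a::comm_ring_1 \<Rightarrow> nat \<Rightarrow> 'a" where
  "qfac x n = (\<Prod>k=1..n. 1 - x ^ k)"

lemma qfac_0 [simp]: "qfac x 0 = 1"
  by (simp add: qfac_def)

lemma qfac_Suc [simp]: "qfac x (Suc n) = qfac x n * (1 - x ^ Suc n)"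
  by (simp add: qfac_def)

text \<open>The q-Pascal rule serves as definition because it needs no division and so works in
  every commutative ring.\<close>

fun gauss_binomial :: "'a::comm_ring_1 \<Rightarrow> nat \<Rightarrow> nat \<Rightarrow> 'a" where
  "gauss_binomial x n 0 = 1"
| "gauss_binomial x 0 (Suc k) = 0"
| "gauss_binomial x (Suc n) (Suc k) = gauss_binomial x n k + x ^ Suc k * gauss_binomial x n (Suc k)"

lemma gauss_binomial_eq_0: "n < k \<Longrightarrow> gauss_binomial x n k = 0"
  by (induction x n k rule: gauss_binomial.induct) auto

lemma gauss_binomial_self: "gauss_binomial x n n = 1"
  by (induction n) (auto simp: gauss_binomial_eq_0)

text \<open>The quotient formula, multiplied out. With n = k + l + 1 the q-Pascal rule reduces to (1
  - x^(k+1)) + x^(k+1) (1 - x^(l+1)) = 1 - x^(n+1).\<close>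

lemma gauss_binomial_qfac:
  "k \<le> n \<Longrightarrow> gauss_binomial x n k * qfac x k * qfac x (n - k) = qfac x n"
proof (induction x n k rule: gauss_binomial.induct)
  case (3 x n k)
  show ?case
  proof (cases "k = n")
    case True
    then show ?thesis by (simp add: gauss_binomial_eq_0 gauss_binomial_self)
  next
    case False
    with 3 have k: "k < n" by simp
    then obtain l where l: "n = Suc (k + l)" by (metis add_Suc_right less_iff_Suc_add)
    have IH: "gauss_binomial x n k * qfac x k * qfac x (Suc l) = qfac x n"
      "gauss_binomial x n (Suc k) * qfac x (Suc k) * qfac x l = qfac x n"
      using 3 k l by (auto simp: Suc_diff_le)
    have "gauss_binomial x (Suc n) (Suc k) * qfac x (Suc k) * qfac x (Suc n - Suc k)
      = (gauss_binomial x n k * qfac x k * qfac x (Suc l)) * (1 - x ^ Suc k)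
        + x ^ Suc k * (gauss_binomial x n (Suc k) * qfac x (Suc k) * qfac x l) * (1 - x ^ Suc l)"
      using l by (simp add: algebra_simps)
    also have "\<dots> = qfac x n * (1 - x ^ Suc k * x ^ Suc l)"
      unfolding IH by (simp add: algebra_simps)
    also have "x ^ Suc k * x ^ Suc l = x ^ Suc n"
      using l by (simp add: power_add algebra_simps)
    finally show ?thesis by simp
  qed
qed auto

section \<open>The q-binomial theorem\<close>

lemma triangle_Suc: "Suc i * i div 2 = i * (i - 1) div 2 + i"
  by (cases i) (auto simp: algebra_simps)

text \<open>The induction splits off the factor for k = 0; the others form the shorter product with
  v * x in place of v. The homogeneous form in u and v permits u = x^n later.\<close>

lemma q_binomial:
  "(\<Prod>k<n. u + v * x ^ k)
     = (\<Sum>i\<le>n. gauss_binomial x n i * x ^ (i * (i - 1) div 2) * u ^ (n - i) * v ^ i)"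
proof (induction n arbitrary: v)
  case (Suc n)
  let ?g = "\<lambda>m i. gauss_binomial x m i"
  let ?t = "\<lambda>i::nat. i * (i - 1) div 2"
  let ?S = "\<Sum>i\<le>n. ?g n i * x ^ ?t (Suc i) * u ^ (n - i) * v ^ i"
  have t: "?t (Suc i) = ?t i + i" for i
    using triangle_Suc[of i] by simp
  have "(\<Prod>k<Suc n. u + v * x ^ k) = (u + v) * (\<Prod>k<n. u + (v * x) * x ^ k)"
    unfolding prod.lessThan_Suc_shift by (simp add: mult.assoc)
  also have "(\<Prod>k<n. u + (v * x) * x ^ k) = ?S"
    unfolding Suc.IH t by (intro sum.cong) (simp_all add: power_mult_distrib power_add algebra_simps)
  finally have L: "(\<Prod>k<Suc n. u + v * x ^ k) = (u + v) * ?S" .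
  \<comment> \<open>These become the q-Pascal terms with \<open>gauss_binomial x n (Suc i)\<close>:
    the range extends to \<open>Suc n\<close> since the new coefficient is zero, and then i = 0 is
    split off.\<close>
  have S': "?S * u = (\<Sum>i\<le>n. ?g n i * x ^ ?t (Suc i) * u ^ (Suc n - i) * v ^ i)"
    unfolding sum_distrib_right by (intro sum.cong refl) (simp add: Suc_diff_le algebra_simps)
  also have "\<dots> = (\<Sum>i\<le>Suc n. ?g n i * x ^ ?t (Suc i) * u ^ (Suc n - i) * v ^ i)"
    by (simp add: gauss_binomial_eq_0)
  also have "\<dots> = u ^ Suc n +
      (\<Sum>i\<le>n. ?g n (Suc i) * x ^ ?t (Suc (Suc i)) * u ^ (n - i) * v ^ Suc i)"
    unfolding sum.atMost_Suc_shift by simp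
  finally have Su: "?S * u = \<dots>" .
  have "(\<Sum>i\<le>Suc n. ?g (Suc n) i * x ^ ?t i * u ^ (Suc n - i) * v ^ i)
    = u ^ Suc n + (\<Sum>i\<le>n. ?g (Suc n) (Suc i) * x ^ ?t (Suc i) * u ^ (n - i) * v ^ Suc i)"
    unfolding sum.atMost_Suc_shift by simp
  also have "(\<Sum>i\<le>n. ?g (Suc n) (Suc i) * x ^ ?t (Suc i) * u ^ (n - i) * v ^ Suc i)
    = v * ?S + (\<Sum>i\<le>n. ?g n (Suc i) * x ^ ?t (Suc (Suc i)) * u ^ (n - i) * v ^ Suc i)"
    unfolding sum_distrib_left sum.distrib[symmetric] t[of "Suc _"]
    by (intro sum.cong refl) (simp add: power_add algebra_simps)
  finally show ?case
    unfolding L using Su by (simp only: algebra_simps)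
qed auto

text \<open>The summand of Ramanujan's general theta function f(a, b). The products j (j + 1) and j
  (j - 1) are even and nonnegative, so \<open>div\<close> and \<open>nat\<close> lose
  nothing.\<close>

definition theta_term :: "'a::comm_ring_1 \<Rightarrow> 'a \<Rightarrow> int \<Rightarrow> 'a" where
  "theta_term a b j = a ^ nat (j * (j + 1) div 2) * b ^ nat (j * (j - 1) div 2)"

text \<open>The exponents of a and b in the i-th term of \<open>q_binomial\<close> for u = x^n, v =
  a, x = a b: a part independent of i plus the exponent in \<open>theta_term\<close>.\<close>

lemma finite_theta_exponents:
  fixes n i :: nat
  assumes i: "i \<le> 2 * n"
  defines "j \<equiv> int i - int n"
  shows "i * (i - 1) div 2 + n * (2 * n - i) + i
           = n * (n - 1) div 2 + n * n + n + nat (j * (j + 1) div 2)" (is ?A)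
    and "i * (i - 1) div 2 + n * (2 * n - i)
           = n * (n - 1) div 2 + n * n + nat (j * (j - 1) div 2)" (is ?B)
proof -
  have tri: "2 * int (k * (k - 1) div 2) = int k * (int k - 1)" for k :: nat
  proof -
    have "2 * (k * (k - 1) div 2) = k * (k - 1)" by (rule dvd_mult_div_cancel) (cases k; simp)
    then have "2 * int (k * (k - 1) div 2) = int (k * (k - 1))" by linarith
    also have "\<dots> = int k * (int k - 1)" by (cases k) (simp_all add: algebra_simps)
    finally show ?thesis .
  qed
  have trj: "2 * int (nat (j * (j + 1) div 2)) = j * (j + 1)" "2 * int (nat (j * (j - 1) div 2)) = j * (j - 1)"
  proof -
    have "0 \<le> j * (j + 1)" "0 \<le> j * (j - 1)"
      unfolding zero_le_mult_iff by presburger+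
    then show "2 * int (nat (j * (j + 1) div 2)) = j * (j + 1)" "2 * int (nat (j * (j - 1) div 2)) = j * (j - 1)"
      by simp_all
  qed
  \<comment> \<open>Comparing doubled integers removes \<open>div 2\<close> and truncated
    subtraction.\<close>
  have double: "2 * int u = 2 * int v \<Longrightarrow> u = v" for u v by simp
  obtain d where d: "2 * n = i + d" using i by (auto simp: le_iff_add)
  then have nd: "2 * n - i = d" and id: "int i = 2 * int n - int d" by linarith+
  have j: "j = int n - int d" unfolding j_def id by simp
  have "2 * int (i * (i - 1) div 2 + n * (2 * n - i) + i)
      = int i * (int i - 1) + 2 * int n * int d + 2 * int i"
    unfolding of_nat_add distrib_left[of 2] tri nd by simp
  also have "\<dots> = int n * (int n - 1) + 2 * int n * int n + 2 * int n + j * (j + 1)"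
    unfolding id j by (simp add: algebra_simps)
  also have "\<dots> = 2 * int (n * (n - 1) div 2 + n * n + n + nat (j * (j + 1) div 2))"
    unfolding of_nat_add distrib_left[of 2] tri trj by simp
  finally show ?A by (rule double)
  have "2 * int (i * (i - 1) div 2 + n * (2 * n - i)) = int i * (int i - 1) + 2 * int n * int d"
    unfolding of_nat_add distrib_left[of 2] tri nd by simp
  also have "\<dots> = int n * (int n - 1) + 2 * int n * int n + j * (j - 1)"
    unfolding id j by (simp add: algebra_simps)
  also have "\<dots> = 2 * int (n * (n - 1) div 2 + n * n + nat (j * (j - 1) div 2))"
    unfolding of_nat_add distrib_left[of 2] tri trj by simp
  finally show ?B by (rule double)
qed

text \<open>The q-binomial theorem for the 2n factors x^n + a x^k. As x = a b, the first n become,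
  up to monomials, the factors 1 + b x^k in reverse order, the last n the factors 1 + a x^k.
  Shifting the index by n centres the sum.\<close>

lemma finite_theta:
  fixes a b :: "'a::idom"
  assumes "a \<noteq> 0" "b \<noteq> 0"
  defines "x \<equiv> a * b"
  shows "(\<Prod>k<n. (1 + a * x ^ k) * (1 + b * x ^ k))
    = (\<Sum>j\<in>{-int n..int n}. gauss_binomial x (2 * n) (nat (int n + j)) * theta_term a b j)"
proof -
  \<comment> \<open>The monomial taken out of all 2n factors, cancelled at the end.\<close>
  define c where "c = x ^ (n * (n - 1) div 2 + n * n) * a ^ n"
  have "c \<noteq> 0" using assms by (simp add: c_def)
  have A: "(\<Prod>k<n. x ^ n + a * x ^ k) = x ^ (n * (n - 1) div 2) * a ^ n * (\<Prod>k<n. 1 + b * x ^ k)"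
  proof -
    have "(\<Prod>k<n. x ^ n + a * x ^ k) = (\<Prod>k<n. x ^ k * a * (1 + b * x ^ (n - Suc k)))"
    proof (intro prod.cong refl)
      fix k assume "k \<in> {..<n}"
      then have "x ^ n = x ^ k * (x * x ^ (n - Suc k))"
        by (simp flip: power_add power_Suc)
      also have "\<dots> = x ^ k * a * (b * x ^ (n - Suc k))"
        unfolding x_def by (simp add: algebra_simps)
      finally show "x ^ n + a * x ^ k = x ^ k * a * (1 + b * x ^ (n - Suc k))"
        by (simp add: algebra_simps)
    qed
    also have "\<dots> = x ^ (\<Sum>k<n. k) * a ^ n * (\<Prod>k<n. 1 + b * x ^ (n - Suc k))"
      by (simp add: prod.distrib power_sum)
    also have "(\<Sum>k<n. k) = n * (n - 1) div 2"
      proof (induction n)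
      case (Suc n)
      then show ?case using triangle_Suc[of n] by simp
    qed simp
    also have "(\<Prod>k<n. 1 + b * x ^ (n - Suc k)) = (\<Prod>k<n. 1 + b * x ^ k)"
      by (rule prod.nat_diff_reindex)
    finally show ?thesis .
  qed
  have B: "(\<Prod>k\<in>{n..<2*n}. x ^ n + a * x ^ k) = x ^ (n * n) * (\<Prod>k<n. 1 + a * x ^ k)"
  proof -
    have "(\<Prod>k\<in>{n..<2*n}. x ^ n + a * x ^ k) = (\<Prod>k<n. x ^ n + a * x ^ (k + n))"
      using prod.shift_bounds_nat_ivl[of "\<lambda>k. x ^ n + a * x ^ k" 0 n n]
      by (simp add: lessThan_atLeast0 mult_2)
    also have "\<dots> = (\<Prod>k<n. x ^ n * (1 + a * x ^ k))"
      by (intro prod.cong) (auto simp: power_add algebra_simps)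
    finally show ?thesis by (simp add: prod.distrib power_mult)
  qed
  have "c * (\<Prod>k<n. (1 + a * x ^ k) * (1 + b * x ^ k)) = (\<Prod>k<n. x ^ n + a * x ^ k) * (\<Prod>k\<in>{n..<2*n}. x ^ n + a * x ^ k)"
    unfolding A B c_def prod.distrib power_add by (simp only: mult_ac)
  also have "\<dots> = (\<Prod>k<2*n. x ^ n + a * x ^ k)"
    unfolding lessThan_atLeast0 by (rule prod.atLeastLessThan_concat) auto
  also have "\<dots> = (\<Sum>i\<le>2*n. gauss_binomial x (2*n) i * x ^ (i * (i - 1) div 2) * (x ^ n) ^ (2 * n - i) * a ^ i)"
    by (rule q_binomial)
  also have "\<dots> = (\<Sum>i\<le>2*n. c * (gauss_binomial x (2*n) i * theta_term a b (int i - int n)))"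
  proof (intro sum.cong refl)
    fix i assume "i \<in> {..2*n}"
    then have i: "i \<le> 2 * n" by simp
    have "x ^ (i * (i - 1) div 2) * (x ^ n) ^ (2 * n - i) * a ^ i
      = a ^ (i * (i - 1) div 2 + n * (2 * n - i) + i) * b ^ (i * (i - 1) div 2 + n * (2 * n - i))"
      unfolding x_def by (simp add: power_mult_distrib power_add algebra_simps flip: power_mult)
    also have "\<dots> = c * theta_term a b (int i - int n)"
      unfolding finite_theta_exponents(1)[OF i] unfolding finite_theta_exponents(2)[OF i] c_def theta_term_def x_def
      by (simp only: power_mult_distrib power_add mult_ac)
    finally show "gauss_binomial x (2*n) i * x ^ (i * (i - 1) div 2) * (x ^ n) ^ (2 * n - i) * a ^ i
       = c * (gauss_binomial x (2*n) i * theta_term a b (int i - int n))"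
      by (simp add: mult_ac)
  qed
  also have "\<dots> = c * (\<Sum>i\<le>2*n. gauss_binomial x (2*n) i * theta_term a b (int i - int n))"
    by (simp add: sum_distrib_left)
  also have "(\<Sum>i\<le>2*n. gauss_binomial x (2*n) i * theta_term a b (int i - int n))
    = (\<Sum>j\<in>{-int n..int n}. gauss_binomial x (2 * n) (nat (int n + j)) * theta_term a b j)"
    by (rule sum.reindex_bij_witness[of _ "\<lambda>j. nat (int n + j)" "\<lambda>i. int i - int n"]) auto
  finally show ?thesis using \<open>c \<noteq> 0\<close> by simp
qed

section \<open>Power series modulo a power of the variable\<close>

text \<open>Congruence modulo the N-th power of the variable; coefficient n is reached with N =
  \<open>Suc n\<close>.\<close>

definition fps_agree :: "nat \<Rightarrow> 'a fps \<Rightarrow> 'a fps \<Rightarrow> bool" where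
  "fps_agree N f g \<longleftrightarrow> (\<forall>i<N. fps_nth f i = fps_nth g i)"

lemma fps_agree_refl [simp]: "fps_agree N f f"
  by (simp add: fps_agree_def)

lemma fps_agree_sym: "fps_agree N f g \<Longrightarrow> fps_agree N g f"
  by (simp add: fps_agree_def)

lemma fps_agree_trans [trans]: "fps_agree N f g \<Longrightarrow> fps_agree N g h \<Longrightarrow> fps_agree N f h"
  by (simp add: fps_agree_def)

lemma fps_agree_add:
  "fps_agree N f f' \<Longrightarrow> fps_agree N g g' \<Longrightarrow> fps_agree N (f + g) (f' + g' :: 'a::monoid_add fps)"
  by (simp add: fps_agree_def)

lemma fps_agree_diff:
  "fps_agree N f f' \<Longrightarrow> fps_agree N g g' \<Longrightarrow> fps_agree N (f - g) (f' - g' :: 'a::group_add fps)"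
  by (simp add: fps_agree_def)

lemma fps_agree_mult:
  "fps_agree N f f' \<Longrightarrow> fps_agree N g g' \<Longrightarrow> fps_agree N (f * g) (f' * g' :: 'a::semiring_0 fps)"
  by (auto simp: fps_agree_def fps_mult_nth intro!: sum.cong)

lemma fps_agree_sum:
  "(\<And>i. i \<in> A \<Longrightarrow> fps_agree N (f i) (g i :: 'a::comm_monoid_add fps)) \<Longrightarrow> fps_agree N (sum f A) (sum g A)"
  by (simp add: fps_agree_def fps_sum_nth)

lemma fps_agree_cancel:
  fixes f g h :: "'a::field fps"
  assumes "fps_agree N (h * f) (h * g)" "fps_nth h 0 \<noteq> 0"
  shows "fps_agree N f g"
proof -
  have "fps_agree N (inverse h * (h * f)) (inverse h * (h * g))"
    by (intro fps_agree_mult assms) simp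
  then show ?thesis
    using inverse_mult_eq_1[OF assms(2)] by (simp flip: mult.assoc)
qed

section \<open>Stabilisation of products and theta sums\<close>

lemma fps_agree_power_0:
  fixes x :: "'a::comm_ring_1 fps"
  assumes "fps_nth x 0 = 0" "N \<le> k"
  shows "fps_agree N (x ^ k) 0"
  using startsby_zero_power_prefix[OF assms(1), of k] assms(2) by (simp add: fps_agree_def)

lemma fps_agree_prod_stable:
  fixes f :: "nat \<Rightarrow> 'a::comm_ring_1 fps"
  assumes "\<And>k. N < k \<Longrightarrow> fps_agree N (f k) 1" "N \<le> m" "m \<le> n"
  shows "fps_agree N (\<Prod>k=1..n. f k) (\<Prod>k=1..m. f k)"
  using assms(3)
proof (induction n rule: dec_induct)
  case (step n)
  have "fps_agree N ((\<Prod>k=1..n. f k) * f (Suc n)) ((\<Prod>k=1..m. f k) * 1)"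
    using step assms by (intro fps_agree_mult) auto
  then show ?case by simp
qed simp

text \<open>The factors 1 - x^k with k > N are congruent to 1, so each \<open>qfac x n\<close> with
  n >= N stands for the infinite product.\<close>

lemma qfac_agree:
  fixes x :: "'a::comm_ring_1 fps"
  assumes "fps_nth x 0 = 0" "N \<le> n"
  shows "fps_agree N (qfac x n) (qfac x N)"
  unfolding qfac_def
proof (rule fps_agree_prod_stable)
  fix k assume "N < k"
  then show "fps_agree N (1 - x ^ k) 1"
    using fps_agree_diff[OF fps_agree_refl fps_agree_power_0[OF assms(1), of N k], of 1] by simp
qed (use assms in auto)

lemma qfac_nth_0 [simp]: "fps_nth x 0 = 0 \<Longrightarrow> fps_nth (qfac x n) 0 = 1"
  by (induction n) auto

text \<open>Both exponents are at least N, so (a b)^N divides the term. Arguing with a b instead of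
  a or b alone matters in (i), where b is a constant series.\<close>

lemma theta_term_agree_0:
  fixes a b :: "'a::comm_ring_1 fps"
  assumes x0: "fps_nth (a * b) 0 = 0" and j: "int N < \<bar>j\<bar>"
  shows "fps_agree N (theta_term a b j) 0"
proof -
  let ?s = "nat (j * (j + 1) div 2)" and ?t = "nat (j * (j - 1) div 2)"
  have "int N \<le> j * (j + 1) div 2 \<and> int N \<le> j * (j - 1) div 2"
  proof (cases "N = 0")
    case True
    have "0 \<le> j * (j + 1)" "0 \<le> j * (j - 1)"
      unfolding zero_le_mult_iff by presburger+
    with True show ?thesis by simp
  next
    case False
    \<comment> \<open>The smaller product, j (j - 1) or j (j + 1) depending on the sign of j, has
      factors of absolute value at least N + 1 and N.\<close>
    have "2 * int N \<le> j * (j + 1) \<and> 2 * int N \<le> j * (j - 1)"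
    proof (cases "j \<ge> 0")
      case True
      have "2 * int N \<le> (int N + 1) * int N" using False by simp
      also have "\<dots> \<le> j * (j - 1)" using True j False by (intro mult_mono) auto
      also have "\<dots> \<le> j * (j + 1)" using True by (intro mult_left_mono) auto
      finally show ?thesis using \<open>(int N + 1) * int N \<le> j * (j - 1)\<close> \<open>2 * int N \<le> (int N + 1) * int N\<close> by linarith
    next
      case neg: False
      have "2 * int N \<le> (int N + 1) * int N" using False by simp
      also have "\<dots> \<le> (- j) * (- j - 1)" using neg j False by (intro mult_mono) auto
      also have "\<dots> = j * (j + 1)" by (simp add: algebra_simps)
      finally have 1: "2 * int N \<le> j * (j + 1)" .
      moreover have "j * (j + 1) \<le> j * (j - 1)" using neg by (simp add: algebra_simps)
      ultimately show ?thesis by linarith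
    qed
    then show ?thesis by linarith
  qed
  then have st: "?s = N + (?s - N)" "?t = N + (?t - N)" by auto
  have "theta_term a b j = (a * b) ^ N * (a ^ (?s - N) * b ^ (?t - N))"
    unfolding theta_term_def by (subst st(1), subst st(2)) (simp add: power_add power_mult_distrib mult_ac)
  moreover have "fps_agree N ((a * b) ^ N * (a ^ (?s - N) * b ^ (?t - N))) (0 * (a ^ (?s - N) * b ^ (?t - N)))"
    by (intro fps_agree_mult fps_agree_refl fps_agree_power_0 x0) simp
  ultimately show ?thesis by simp
qed

text \<open>Terms with |j| > N vanish on both sides. For |j| <= N the bound m >= 2 N makes m + j and
  m - j at least N, and then the quotient formula gives \<open>qfac\<close> times the Gaussian
  binomial congruent to 1.\<close>

lemma theta_agree:
  fixes a b :: "'a::field fps"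
  assumes "a \<noteq> 0" "b \<noteq> 0" and x0: "fps_nth (a * b) 0 = 0" and "N \<le> M" "2 * N \<le> m"
  shows "fps_agree N (qfac (a * b) M * (\<Prod>k<m. (1 + a * (a * b) ^ k) * (1 + b * (a * b) ^ k)))
    (\<Sum>j\<in>{-int m..int m}. theta_term a b j)"
proof -
  let ?x = "a * b"
  let ?P = "qfac ?x"
  let ?G = "\<lambda>j. gauss_binomial ?x (2 * m) (nat (int m + j))"
  have "fps_agree N (?P M * (?G j * theta_term a b j)) (theta_term a b j)"
    if j: "j \<in> {-int m..int m}" for j
  proof (cases "int N < \<bar>j\<bar>")
    case True
    have "fps_agree N (?P M * (?G j * theta_term a b j)) (?P M * (?G j * 0))"
      by (intro fps_agree_mult fps_agree_refl theta_term_agree_0 x0 True)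
    also have "fps_agree N (?P M * (?G j * 0)) (theta_term a b j)"
      using fps_agree_sym[OF theta_term_agree_0[OF x0 True]] by simp
    finally show ?thesis .
  next
    case False
    let ?k = "nat (int m + j)"
    have k: "?k \<le> 2 * m" "N \<le> ?k" "N \<le> 2 * m - ?k" using False j assms(5) by auto
    \<comment> \<open>Every \<open>qfac\<close> in the quotient formula has length at least N and
      may be exchanged for \<open>?P N\<close>; one copy is then cancelled.\<close>
    have "fps_agree N (?G j * ?P N * ?P N) (?G j * ?P ?k * ?P (2 * m - ?k))"
      by (intro fps_agree_mult fps_agree_refl fps_agree_sym[OF qfac_agree] x0 k)
    also have "\<dots> = ?P (2 * m)" by (rule gauss_binomial_qfac) (rule k)
    also have "fps_agree N \<dots> (?P N)" by (rule qfac_agree) (use x0 assms in auto)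
    finally have "fps_agree N (?P N * (?P N * ?G j)) (?P N * 1)" by (simp add: mult_ac)
    then have "fps_agree N (?P N * ?G j) 1" by (rule fps_agree_cancel) (use x0 in simp)
    moreover have "fps_agree N (?P M * ?G j) (?P N * ?G j)"
      by (intro fps_agree_mult fps_agree_refl qfac_agree x0 assms)
    ultimately have "fps_agree N (?P M * ?G j) 1" by (rule fps_agree_trans[rotated])
    then have "fps_agree N (?P M * ?G j * theta_term a b j) (1 * theta_term a b j)"
      by (intro fps_agree_mult fps_agree_refl)
    then show ?thesis by (simp add: mult.assoc)
  qed
  then show ?thesis
    unfolding finite_theta[OF assms(1,2)] sum_distrib_left by (rule fps_agree_sum)
qed

section \<open>Generating functions of partitions\<close>

text \<open>Without a part 0, the sum bounds the number of parts and each part, leaving finitely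
  many lists.\<close>

lemma finite_multisets_weighted_sum:
  fixes S :: "nat set"
  assumes "0 \<notin> S" "d > 0"
  shows "finite {M. set_mset M \<subseteq> S \<and> d * sum_mset M = i}"
proof (rule finite_subset)
  have "size M \<le> sum_mset M \<and> (\<forall>k\<in>#M. k \<le> sum_mset M)" if "set_mset M \<subseteq> S" for M
    using that
  proof (induction M)
    case (add k M)
    then have "k > 0" using assms(1) by (cases k) auto
    with add show ?case by auto
  qed simp
  moreover have "sum_mset M \<le> d * sum_mset M" for M using assms(2) by simp
  ultimately have "size M \<le> d * sum_mset M \<and> (\<forall>k\<in>#M. k \<le> d * sum_mset M)" if "set_mset M \<subseteq> S" for M
    using that by (meson order_trans)
  then show "{M. set_mset M \<subseteq> S \<and> d * sum_mset M = i}
    \<subseteq> mset ` {xs. set xs \<subseteq> {..i} \<and> length xs \<le> i}"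
  proof (intro subsetI)
    fix M assume M: "M \<in> {M. set_mset M \<subseteq> S \<and> d * sum_mset M = i}"
    obtain xs where xs: "mset xs = M" using ex_mset by blast
    have "size M \<le> i \<and> (\<forall>k\<in>#M. k \<le> i)"
      using M \<open>\<And>M. set_mset M \<subseteq> S \<Longrightarrow> size M \<le> d * sum_mset M \<and> (\<forall>k\<in>#M. k \<le> d * sum_mset M)\<close>
      by auto
    with xs show "M \<in> mset ` {xs. set xs \<subseteq> {..i} \<and> length xs \<le> i}"
      by (auto intro!: image_eqI[of _ _ xs])
  qed
  show "finite (mset ` {xs::nat list. set xs \<subseteq> {..i} \<and> length xs \<le> i})"
    by (intro finite_imageI finite_lists_length_le) simp
qed

text \<open>A part k has weight d k; d = 1 serves (i) and d = 3 serves (ii). For finite S without 0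
  this is the reciprocal of the product of 1 - X^(d k).\<close>

definition parts_gf :: "nat set \<Rightarrow> nat \<Rightarrow> 'a::comm_ring_1 fps" where
  "parts_gf S d = Abs_fps (\<lambda>i. of_nat (card {M. set_mset M \<subseteq> S \<and> d * sum_mset M = i}))"

text \<open>Removing one copy of k maps the multisets containing k onto all multisets of weight i -
  d k; subtracting these leaves the multisets that avoid k.\<close>

lemma parts_gf_insert:
  assumes "0 \<notin> insert k S" "k \<notin> S" "d > 0"
  shows "parts_gf (insert k S) d * (1 - fps_X ^ (d * k)) = (parts_gf S d :: 'a::comm_ring_1 fps)"
proof (rule fps_ext)
  fix i
  let ?A = "\<lambda>S i. {M. set_mset M \<subseteq> S \<and> d * sum_mset M = i}"
  have fin: "finite (?A T j)" if "0 \<notin> T" for T :: "nat set" and j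
    using finite_multisets_weighted_sum[OF that assms(3)] .
  let ?B = "{M. set_mset M \<subseteq> insert k S \<and> k \<in># M \<and> d * sum_mset M = i}"
  have split: "?A (insert k S) i = ?A S i \<union> ?B" using assms(2) by auto
  have cB: "card ?B = (if i < d * k then 0 else card (?A (insert k S) (i - d * k)))"
  proof (cases "i < d * k")
    case True
    have "?B = {}"
    proof -
      have False if "k \<in># M" "d * sum_mset M = i" for M
        using that True by (auto dest!: multi_member_split)
      then show ?thesis by blast
    qed
    then show ?thesis using True by (simp only: card.empty if_True)
  next
    case False
    have "bij_betw (add_mset k) (?A (insert k S) (i - d * k)) ?B"
    proof (rule bij_betw_byWitness[of _ "\<lambda>M. M - {#k#}"])
      show "add_mset k ` ?A (insert k S) (i - d * k) \<subseteq> ?B"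
        using False by (auto simp: algebra_simps)
      show "(\<lambda>M. M - {#k#}) ` ?B \<subseteq> ?A (insert k S) (i - d * k)"
      proof (intro subsetI, elim imageE)
        fix M L assume "L = M - {#k#}" "M \<in> ?B"
        moreover from this obtain M' where "M = add_mset k M'" by (auto dest!: multi_member_split)
        ultimately show "L \<in> ?A (insert k S) (i - d * k)" by (auto simp: algebra_simps)
      qed
    qed auto
    then show ?thesis using False by (simp add: bij_betw_same_card)
  qed
  have "card (?A (insert k S) i) = card (?A S i) + card ?B"
    unfolding split
  proof (rule card_Un_disjoint)
    show "finite ?B" using fin[OF assms(1), of i] by (rule rev_finite_subset) auto
    show "finite (?A S i)" using assms(1) by (intro fin) auto
    show "?A S i \<inter> ?B = {}" using assms(2) by auto
  qed
  then show "fps_nth (parts_gf (insert k S) d * (1 - fps_X ^ (d * k))) i = fps_nth (parts_gf S d :: 'a fps) i"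
    unfolding cB by (simp add: parts_gf_def algebra_simps fps_X_power_mult_right_nth fps_X_power_mult_nth)
qed

lemma parts_gf_empty: "d > 0 \<Longrightarrow> parts_gf {} d = (1 :: 'a::comm_ring_1 fps)"
proof (rule fps_ext)
  fix i :: nat
  have "{M. set_mset M \<subseteq> {} \<and> d * sum_mset M = i} = (if i = 0 then {{#}} else {})" by auto
  then show "fps_nth (parts_gf {} d) i = fps_nth (1 :: 'a fps) i"
    by (simp add: parts_gf_def)
qed

lemma parts_gf_prod:
  assumes "d > 0" "finite S" "0 \<notin> S"
  shows "parts_gf S d * (\<Prod>k\<in>S. 1 - fps_X ^ (d * k)) = (1 :: 'a::comm_ring_1 fps)"
  using assms(2,3)
proof (induction S)
  case empty
  then show ?case using assms(1) by (simp add: parts_gf_empty)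
next
  case (insert k S)
  then show ?case
    using parts_gf_insert[of k S d, where 'a='a] assms(1) by (simp flip: mult.assoc)
qed

lemma partition_part_le: "M \<in> partitions n \<Longrightarrow> k \<in># M \<Longrightarrow> 1 \<le> k \<and> k \<le> n"
  by (auto simp: partitions_def Suc_le_eq dest!: multi_member_split intro: gr0I)

text \<open>The bound n on the parts excludes nothing as i <= n. If d does not divide i, no multiset
  has weight i, in accordance with \<open>p\<close> vanishing off the integers.\<close>

lemma parts_gf_nth:
  assumes "d > 0" "i \<le> n"
  shows "fps_nth (parts_gf {1..n} d) i = of_nat (p (real i / real d))"
proof (cases "d dvd i")
  case True
  then obtain l where l: "i = d * l" by blast
  then have "l \<le> n" using assms by (metis le_trans mult.commute mult_le_mono2 mult.right_neutral Suc_leI One_nat_def)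
  then have "{M. set_mset M \<subseteq> {1..n} \<and> d * sum_mset M = i} = partitions l"
  proof (intro equalityI subsetI)
    fix M assume "M \<in> partitions l"
    moreover from this have "set_mset M \<subseteq> {1..n}"
      using partition_part_le[of M l] \<open>l \<le> n\<close> by (meson atLeastAtMost_iff le_trans subsetI)
    ultimately show "M \<in> {M. set_mset M \<subseteq> {1..n} \<and> d * sum_mset M = i}"
      by (simp add: l partitions_def)
  qed (use assms(1) l in \<open>auto simp: partitions_def\<close>)
  moreover have "real i / real d = real l" using l assms(1) by simp
  ultimately show ?thesis by (simp add: parts_gf_def p_def num_partitions_def)
next
  case False
  have "real i / real d \<notin> \<nat>"
  proof
    assume "real i / real d \<in> \<nat>"
    then obtain l where "real i / real d = real l" by (auto elim: Nats_cases)
    then have "real i = real (d * l)" using assms(1) by (simp add: field_simps)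
    then show False using False by (metis dvd_triv_left of_nat_eq_iff)
  qed
  moreover have "{M. set_mset M \<subseteq> {1..n} \<and> d * sum_mset M = i} = {}" using False by auto
  ultimately show ?thesis by (simp only: parts_gf_def p_def fps_nth_Abs_fps card.empty of_nat_0 if_False)
qed

section \<open>The generating function of \<open>Q\<^sub>2\<close>\<close>

definition Q\<^sub>2_parts :: "nat \<Rightarrow> nat set" where
  "Q\<^sub>2_parts m = {k \<in> {1..m}. k mod 6 \<noteq> 2 \<and> k mod 6 \<noteq> 4}"

lemma Q\<^sub>2_parts_cong: "k mod 6 \<noteq> 2 \<and> k mod 6 \<noteq> 4 \<longleftrightarrow> \<not> [int k = 2] (mod 6) \<and> \<not> [int k = - 2] (mod 6)"
proof -
  have "int k mod 6 = int (k mod 6)" by (simp add: zmod_int)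
  then show ?thesis by (auto simp: cong_def)
qed

text \<open>Multisets without repetition are sets, via \<open>set_mset\<close> and
  \<open>mset_set\<close>. Cutting the parts off at m is harmless since parts of a partition of n
  are at most n.\<close>

lemma Q\<^sub>2_eq_card_sets:
  assumes "n \<le> m"
  shows "Q\<^sub>2 n = card {A. A \<subseteq> Q\<^sub>2_parts m \<and> \<Sum>A = n}"
proof -
  have fin: "finite A" if "A \<subseteq> Q\<^sub>2_parts m" for A
    using that by (rule finite_subset) (simp add: Q\<^sub>2_parts_def)
  have uni: "mset_set (set_mset M) = M" if "\<forall>k. count M k \<le> 1" for M :: "nat multiset"
  proof (rule multiset_eqI)
    fix k show "count (mset_set (set_mset M)) k = count M k"
      using that[rule_format, of k] by (cases "k \<in># M") (auto simp: count_mset_set' not_in_iff simp flip: count_greater_zero_iff)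
  qed
  have "bij_betw set_mset {M \<in> partitions n. (\<forall>k. count M k \<le> 1) \<and>
      (\<forall>k\<in>#M. \<not> [int k = 2] (mod 6) \<and> \<not> [int k = - 2] (mod 6))} {A. A \<subseteq> Q\<^sub>2_parts m \<and> \<Sum>A = n}"
    (is "bij_betw _ ?L ?R")
  proof (rule bij_betw_byWitness[of _ mset_set])
    show "\<forall>M\<in>?L. mset_set (set_mset M) = M" using uni by auto
    show "\<forall>A\<in>?R. set_mset (mset_set A) = A" using fin by auto
    show "set_mset ` ?L \<subseteq> ?R"
    proof (intro subsetI, elim imageE)
      fix A M assume A: "A = set_mset M" and M: "M \<in> ?L"
      have "\<Sum>A = sum_mset (mset_set A)" by (simp add: sum_unfold_sum_mset)
      also have "\<dots> = n" using M uni A by (auto simp: partitions_def)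
      finally have "\<Sum>A = n" .
      moreover have "A \<subseteq> Q\<^sub>2_parts m"
        using M assms partition_part_le[of M n] unfolding A Q\<^sub>2_parts_def Q\<^sub>2_parts_cong by fastforce
      ultimately show "A \<in> ?R" by simp
    qed
    show "mset_set ` ?R \<subseteq> ?L"
    proof (intro subsetI, elim imageE)
      fix A M assume M: "M = mset_set A" and A: "A \<in> ?R"
      then have f: "finite A" using fin by simp
      have "sum_mset M = n" using A by (simp add: M sum_unfold_sum_mset)
      moreover have "0 \<notin># M" using A f by (auto simp: M Q\<^sub>2_parts_def)
      moreover have "\<forall>k. count M k \<le> 1" by (simp add: M count_mset_set')
      moreover have "\<forall>k\<in>#M. \<not> [int k = 2] (mod 6) \<and> \<not> [int k = - 2] (mod 6)"
        using A f unfolding M Q\<^sub>2_parts_def Q\<^sub>2_parts_cong by auto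
      ultimately show "M \<in> ?L" by (auto simp: partitions_def)
    qed
  qed
  then show ?thesis unfolding Q\<^sub>2_def by (rule bij_betw_same_card)
qed

text \<open>The expanded product has one monomial per subset A, with the sum of A as
  exponent.\<close>

lemma distinct_gf_nth:
  fixes S :: "nat set"
  assumes "finite S"
  shows "fps_nth (\<Prod>k\<in>S. 1 + fps_X ^ k :: 'a::comm_ring_1 fps) n = of_nat (card {A. A \<subseteq> S \<and> \<Sum>A = n})"
proof -
  have "(\<Prod>k\<in>S. fps_X ^ k + 1 :: 'a fps) = (\<Sum>A\<in>Pow S. fps_X ^ \<Sum>A)"
    using assms by (simp add: prod_add power_sum)
  then have "fps_nth (\<Prod>k\<in>S. 1 + fps_X ^ k :: 'a fps) n = (\<Sum>A\<in>Pow S. if \<Sum>A = n then 1 else 0)"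
    by (simp add: add.commute fps_sum_nth fps_X_power_iff eq_commute)
  also have "\<dots> = of_nat (card {A\<in>Pow S. \<Sum>A = n})"
    using assms by (simp add: sum.If_cases Int_def)
  finally show ?thesis by (simp add: Pow_def)
qed

lemma Q\<^sub>2_gf_nth:
  "n \<le> m \<Longrightarrow> fps_nth (\<Prod>k\<in>Q\<^sub>2_parts m. 1 + fps_X ^ k :: 'a::comm_ring_1 fps) n = of_nat (Q\<^sub>2 n)"
  by (subst distinct_gf_nth) (auto simp: Q\<^sub>2_eq_card_sets Q\<^sub>2_parts_def)

section \<open>The two specialisations\<close>

lemma power_power_eq: "d * i = j \<Longrightarrow> (q ^ d) ^ i = (q :: 'a::monoid_mult) ^ j"
  by (auto simp: power_mult)

lemma qfac_square: "qfac q n * (\<Prod>k=1..n. 1 + q ^ k) = qfac (q\<^sup>2) n"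
proof -
  have "(1 - q ^ k) * (1 + q ^ k) = 1 - (q\<^sup>2) ^ k" for k
    by (simp add: algebra_simps flip: power_mult power_add mult_2)
  then show ?thesis by (simp add: qfac_def flip: prod.distrib)
qed

text \<open>Raising m by one appends a full period of six integers, four of them allowed; the next
  two inductions rest on this.\<close>

lemma Q\<^sub>2_prod_Suc:
  fixes f :: "nat \<Rightarrow> 'a::comm_monoid_mult"
  shows "(\<Prod>k\<in>Q\<^sub>2_parts (6 * Suc m). f k)
    = (\<Prod>k\<in>Q\<^sub>2_parts (6 * m). f k) * (f (6*m+1) * f (6*m+3) * f (6*m+5) * f (6*m+6))"
proof -
  let ?n = "6 * m" and ?P = "\<lambda>k::nat. k mod 6 \<noteq> 2 \<and> k mod 6 \<noteq> 4"
  have "6 * Suc m = Suc (Suc (Suc (Suc (Suc (Suc ?n)))))" by simp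
  then have "{1..6 * Suc m} = {1..?n} \<union> {?n+1, ?n+2, ?n+3, ?n+4, ?n+5, ?n+6}"
    by (simp only: atLeastAtMostSuc_conv) auto
  then have "Q\<^sub>2_parts (6 * Suc m) = Q\<^sub>2_parts ?n \<union> {k \<in> {?n+1, ?n+2, ?n+3, ?n+4, ?n+5, ?n+6}. ?P k}"
    unfolding Q\<^sub>2_parts_def by blast
  moreover have "?P (?n+1)" "\<not> ?P (?n+2)" "?P (?n+3)" "\<not> ?P (?n+4)" "?P (?n+5)" "?P (?n+6)"
    by presburger+
  then have "{k \<in> {?n+1, ?n+2, ?n+3, ?n+4, ?n+5, ?n+6}. ?P k} = {?n+1, ?n+3, ?n+5, ?n+6}"
    by blast
  ultimately have *: "Q\<^sub>2_parts (6 * Suc m) = Q\<^sub>2_parts ?n \<union> {?n+1, ?n+3, ?n+5, ?n+6}" by simp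
  have "k \<le> ?n" if "k \<in> Q\<^sub>2_parts ?n" for k using that by (simp add: Q\<^sub>2_parts_def)
  then have "Q\<^sub>2_parts ?n \<inter> {?n+1, ?n+3, ?n+5, ?n+6} = {}" by fastforce
  moreover have "finite (Q\<^sub>2_parts ?n)" by (simp add: Q\<^sub>2_parts_def)
  ultimately have "(\<Prod>k\<in>Q\<^sub>2_parts (6 * Suc m). f k)
      = (\<Prod>k\<in>Q\<^sub>2_parts ?n. f k) * (\<Prod>k\<in>{?n+1, ?n+3, ?n+5, ?n+6}. f k)"
    unfolding * by (intro prod.union_disjoint) auto
  also have "(\<Prod>k\<in>{?n+1, ?n+3, ?n+5, ?n+6}. f k) = f (?n+1) * f (?n+3) * f (?n+5) * f (?n+6)"
    by (simp add: mult.assoc)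
  finally show ?thesis .
qed

lemma prod_1_Suc: "(\<Prod>k=1..Suc n. f k) = (\<Prod>k=1..n. f k) * (f (Suc n) :: 'a::comm_monoid_mult)"
  by simp

text \<open>The allowed parts are the multiples of 3 and the numbers congruent to 1 or 5 modulo
  6.\<close>

lemma Q\<^sub>2_prod_mod_3:
  fixes q :: "'a::comm_ring_1"
  shows "(\<Prod>k\<in>Q\<^sub>2_parts (6 * m). 1 + q ^ k)
    = (\<Prod>k<m. (1 + q * (q ^ 6) ^ k) * (1 + q ^ 5 * (q ^ 6) ^ k)) * (\<Prod>k=1..2*m. 1 + (q ^ 3) ^ k)"
proof (induction m)
  case 0
  then show ?case by (simp add: Q\<^sub>2_parts_def)
next
  case (Suc m)
  have u: "(q ^ 6) ^ m = q ^ (6*m)" by (rule power_power_eq) simp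
  have e: "q * (q ^ 6) ^ m = q ^ (6*m+1)" "q ^ 5 * (q ^ 6) ^ m = q ^ (6*m+5)"
    unfolding u by (simp_all add: power_add)
  have e': "(q ^ 3) ^ Suc (2*m) = q ^ (6*m+3)" "(q ^ 3) ^ Suc (Suc (2*m)) = q ^ (6*m+6)"
    by (rule power_power_eq, simp)+
  have s: "2 * Suc m = Suc (Suc (2 * m))" by simp
  show ?case
    unfolding Q\<^sub>2_prod_Suc Suc.IH s prod.lessThan_Suc prod_1_Suc e e' by (simp only: mult_ac)
qed

text \<open>The forbidden parts are the even numbers that are not multiples of 6. Their removal is
  written without division.\<close>

lemma Q\<^sub>2_prod_mod_2:
  fixes q :: "'a::comm_ring_1"
  shows "(\<Prod>k\<in>Q\<^sub>2_parts (6 * m). 1 + q ^ k) * (\<Prod>k=1..3*m. 1 + q ^ (2 * k))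
    = (\<Prod>k=1..6*m. 1 + q ^ k) * (\<Prod>k=1..m. 1 + q ^ (6 * k))"
proof (induction m)
  case 0
  then show ?case by (simp add: Q\<^sub>2_parts_def)
next
  case (Suc m)
  let ?n = "6 * m"
  have s: "3 * Suc m = Suc (Suc (Suc (3 * m)))"
    "6 * Suc m = Suc (Suc (Suc (Suc (Suc (Suc ?n)))))" by simp_all
  have e: "2 * Suc (3*m) = ?n + 2" "2 * Suc (Suc (3*m)) = ?n + 4" "2 * Suc (Suc (Suc (3*m))) = ?n + 6"
    "Suc ?n = ?n + 1" "Suc (?n + 1) = ?n + 2" "Suc (?n + 2) = ?n + 3" "Suc (?n + 3) = ?n + 4"
    "Suc (?n + 4) = ?n + 5" "Suc (?n + 5) = ?n + 6" "6 * Suc m = ?n + 6" by simp_all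
  let ?A = "\<Prod>k\<in>Q\<^sub>2_parts (6 * m). 1 + q ^ k" and ?B = "\<Prod>k=1..3*m. 1 + q ^ (2 * k)"
  let ?C = "\<Prod>k=1..6*m. 1 + q ^ k" and ?D = "\<Prod>k=1..m. 1 + q ^ (6 * k)"
  have A: "(\<Prod>k\<in>Q\<^sub>2_parts (6 * Suc m). 1 + q ^ k)
    = ?A * ((1 + q ^ (?n+1)) * (1 + q ^ (?n+3)) * (1 + q ^ (?n+5)) * (1 + q ^ (?n+6)))"
    by (rule Q\<^sub>2_prod_Suc)
  have B: "(\<Prod>k=1..3*Suc m. 1 + q ^ (2 * k)) = ?B * ((1 + q ^ (?n+2)) * (1 + q ^ (?n+4)) * (1 + q ^ (?n+6)))"
    unfolding s(1) prod_1_Suc e(1-3) by (simp only: mult_ac)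
  have C: "(\<Prod>k=1..6*Suc m. 1 + q ^ k) = ?C * ((1 + q ^ (?n+1)) * (1 + q ^ (?n+2)) * (1 + q ^ (?n+3))
      * (1 + q ^ (?n+4)) * (1 + q ^ (?n+5)) * (1 + q ^ (?n+6)))"
    unfolding s(2) prod_1_Suc unfolding e(4-9) by (simp only: mult_ac)
  have D: "(\<Prod>k=1..Suc m. 1 + q ^ (6 * k)) = ?D * (1 + q ^ (?n+6))"
    unfolding prod_1_Suc e(10) ..
  have "?A * ?B * ((1 + q ^ (?n+1)) * (1 + q ^ (?n+3)) * (1 + q ^ (?n+5)) * (1 + q ^ (?n+6))
      * ((1 + q ^ (?n+2)) * (1 + q ^ (?n+4)) * (1 + q ^ (?n+6))))
    = ?C * ?D * ((1 + q ^ (?n+1)) * (1 + q ^ (?n+3)) * (1 + q ^ (?n+5)) * (1 + q ^ (?n+6))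
      * ((1 + q ^ (?n+2)) * (1 + q ^ (?n+4)) * (1 + q ^ (?n+6))))"
    unfolding Suc.IH ..
  then show ?case unfolding A B C D by (simp only: mult_ac)
qed

text \<open>The factors with W^2 have exponents 0, ..., 2m - 2, the others 2, ..., 2m. The extra
  factor on the left completes the last triple, and 1 + W^2 on the right is the unmatched first
  factor; each triple collapses to 1 + y^3.\<close>

lemma cube_root_prod:
  fixes q W :: "'a::comm_ring_1"
  assumes W: "1 + W + W\<^sup>2 = 0"
  shows "(\<Prod>k<m. (1 + W * q\<^sup>2 * (q\<^sup>2) ^ k) * (1 + W\<^sup>2 * (q\<^sup>2) ^ k)) * (\<Prod>k=1..m. 1 + q ^ (2 * k))
      * (1 + W\<^sup>2 * q ^ (2 * m)) = (1 + W\<^sup>2) * (\<Prod>k=1..m. 1 + q ^ (6 * k))"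
proof (induction m)
  case (Suc m)
  define y where "y = q ^ (2 * Suc m)"
  let ?A = "\<Prod>k<m. (1 + W * q\<^sup>2 * (q\<^sup>2) ^ k) * (1 + W\<^sup>2 * (q\<^sup>2) ^ k)"
  let ?B = "\<Prod>k=1..m. 1 + q ^ (2 * k)"
  have cubic: "(1 + W * y) * (1 + y) * (1 + W\<^sup>2 * y) = 1 + y ^ 3"
  proof -
    \<comment> \<open>Each coefficient in y of the difference is a multiple of 1 + W + W^2; the
      cofactor collects the quotients.\<close>
    have "(1 + W * y) * (1 + y) * (1 + W\<^sup>2 * y) - (1 + y ^ 3)
      = (1 + W + W\<^sup>2) * (y + y\<^sup>2 * W + y ^ 3 * (W - 1))"
      by (simp add: algebra_simps power2_eq_square power3_eq_cube)
    then show ?thesis using W by simp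
  qed
  have e: "(q\<^sup>2) ^ m = q ^ (2 * m)" "W * q\<^sup>2 * q ^ (2 * m) = W * y"
    unfolding y_def by (simp_all add: mult.assoc flip: power_mult power_add)
  have e': "q ^ (6 * Suc m) = y ^ 3"
    unfolding y_def by (rule power_power_eq[symmetric]) simp
  have "?A * ((1 + W * y) * (1 + W\<^sup>2 * q ^ (2 * m))) * (?B * (1 + y)) * (1 + W\<^sup>2 * y)
    = (?A * ?B * (1 + W\<^sup>2 * q ^ (2 * m))) * ((1 + W * y) * (1 + y) * (1 + W\<^sup>2 * y))"
    by (simp only: mult_ac)
  also have "\<dots> = (1 + W\<^sup>2) * ((\<Prod>k=1..m. 1 + q ^ (6 * k)) * (1 + y ^ 3))"
    unfolding Suc.IH cubic by (simp only: mult_ac)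
  finally show ?case
    unfolding prod.lessThan_Suc prod_1_Suc e e' y_def[symmetric] .
qed simp

section \<open>Theta terms at the two specialisations\<close>

lemma sum_pair_neg:
  fixes f :: "int \<Rightarrow> 'a::comm_monoid_add"
  shows "(\<Sum>j\<in>{-int m..int m}. f j) = (\<Sum>j<m. f (int j) + f (-1 - int j)) + f (int m)"
proof (induction m)
  case (Suc m)
  \<comment> \<open>The new index -1 - m is the partner of m, unpaired so far; m + 1 is the new
    unpaired index.\<close>
  have "{-int (Suc m)..int (Suc m)} = insert (int (Suc m)) (insert (-1 - int m) {-int m..int m})"
    by auto
  then have "(\<Sum>j\<in>{-int (Suc m)..int (Suc m)}. f j)
    = f (int (Suc m)) + (f (-1 - int m) + (\<Sum>j\<in>{-int m..int m}. f j))"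
    by simp
  then show ?case using Suc.IH by (simp add: add_ac)
qed simp

text \<open>According to j modulo 3 the sum is 1 + W^2, 2 W or W^2 + 1, and W = -(1 + W^2) yields
  the value -2. The equation for W replaces a concrete root of unity, so W may be a constant power
  series.\<close>

lemma cube_root_power:
  fixes W :: "'a::comm_ring_1"
  assumes W: "1 + W + W\<^sup>2 = 0"
  shows "W ^ 3 = 1" and "W ^ j + W ^ (2 * j + 2) = (1 + W\<^sup>2) * of_int (\<rho> (int j))"
proof -
  have "W ^ 3 - 1 = (W - 1) * (1 + W + W\<^sup>2)"
    by (simp add: algebra_simps power2_eq_square power3_eq_cube)
  then show W3: "W ^ 3 = 1" using W by simp
  have red: "W ^ (3 * i + r) = W ^ r" for i r
    by (simp add: power_add power_mult W3)
  have "W + (1 + W\<^sup>2) = 0" using W by (simp add: add_ac)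
  then have W2: "W = - (1 + W\<^sup>2)" by (simp only: eq_neg_iff_add_eq_0)
  define i where "i = j div 3"
  consider "j = 3 * i" | "j = 3 * i + 1" | "j = 3 * i + 2" unfolding i_def by linarith
  then show "W ^ j + W ^ (2 * j + 2) = (1 + W\<^sup>2) * of_int (\<rho> (int j))"
  proof cases
    case 1
    then have "int j = 3 * int i" "j = 3 * i + 0" "2 * j + 2 = 3 * (2 * i) + 2" by simp_all
    then have "\<rho> (int j) = 1" "W ^ j = 1" "W ^ (2 * j + 2) = W\<^sup>2"
      by (simp add: \<rho>_def cong_def, metis power_0 red, metis red)
    then show ?thesis by simp
  next
    case 2
    then have "int j = 3 * int i + 1" "2 * j + 2 = 3 * (2 * i + 1) + 1" by simp_all
    then have "\<rho> (int j) = - 2" "W ^ j = W" "W ^ (2 * j + 2) = W"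
      by (simp add: \<rho>_def cong_def, metis 2 power_one_right red, metis power_one_right red)
    moreover have "W + W = (1 + W\<^sup>2) * of_int (- 2)"
      by (subst (1 2) W2) simp
    ultimately show ?thesis by simp
  next
    case 3
    then have "int j = 3 * int i + 2" "2 * j + 2 = 3 * (2 * i + 2) + 0" by simp_all
    then have "\<rho> (int j) = 1" "W ^ j = W\<^sup>2" "W ^ (2 * j + 2) = 1"
      by (simp add: \<rho>_def cong_def, metis 3 red, metis power_0 red)
    then show ?thesis by (simp add: add.commute)
  qed
qed

text \<open>The indices j and -1 - j give the first argument the same exponent j (j + 1) / 2, hence
  q the same power; the exponents of W reduce modulo 3 to j and 2 j + 2.\<close>

lemma theta_term_cube_root:
  fixes q W :: "'a::comm_ring_1"
  assumes W: "1 + W + W\<^sup>2 = 0"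
  shows "theta_term (W * q\<^sup>2) (W\<^sup>2) (int j) + theta_term (W * q\<^sup>2) (W\<^sup>2) (- 1 - int j)
    = (1 + W\<^sup>2) * (of_int (\<rho> (int j)) * q ^ (j * (j + 1)))"
proof -
  define S where "S = j * (j - 1) div 2"
  have T: "j * (j + 1) div 2 = S + j" "(j + 1) * (j + 2) div 2 = S + 2 * j + 1"
    using triangle_Suc[of j] triangle_Suc[of "Suc j"] by (simp_all add: S_def mult.commute)
  have jj: "2 * (S + j) = j * (j + 1)" unfolding T(1)[symmetric] by simp
  have "int j * (int j + 1) = int (j * (j + 1))" "int j * (int j - 1) = int (j * (j - 1))"
    "(- 1 - int j) * ((- 1 - int j) + 1) = int (j * (j + 1))"
    "(- 1 - int j) * ((- 1 - int j) - 1) = int ((j + 1) * (j + 2))"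
    by (cases j; simp add: algebra_simps)+
  moreover have "nat (int k div 2) = k div 2" for k
    by (simp add: nat_div_distrib)
  ultimately have n: "nat (int j * (int j + 1) div 2) = S + j" "nat (int j * (int j - 1) div 2) = S"
    "nat ((- 1 - int j) * ((- 1 - int j) + 1) div 2) = S + j"
    "nat ((- 1 - int j) * ((- 1 - int j) - 1) div 2) = S + 2 * j + 1"
    by (simp_all only: T S_def[symmetric])
  have W3: "W ^ (3 * i + r) = W ^ r" for i r
    by (simp add: power_add power_mult cube_root_power(1)[OF W])
  have "theta_term (W * q\<^sup>2) (W\<^sup>2) (int j) = W ^ (S + j + 2 * S) * q ^ (2 * (S + j))"
    unfolding theta_term_def n power_mult power_add power_mult_distrib by (simp only: mult_ac)
  also have "S + j + 2 * S = 3 * S + j" by simp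
  finally have 1: "theta_term (W * q\<^sup>2) (W\<^sup>2) (int j) = W ^ j * q ^ (j * (j + 1))"
    unfolding W3 jj .
  have "theta_term (W * q\<^sup>2) (W\<^sup>2) (- 1 - int j) = W ^ (S + j + 2 * (S + 2 * j + 1)) * q ^ (2 * (S + j))"
    unfolding theta_term_def n power_mult power_add power_mult_distrib by (simp only: mult_ac)
  also have "S + j + 2 * (S + 2 * j + 1) = 3 * (S + j) + (2 * j + 2)" by simp
  finally have 2: "theta_term (W * q\<^sup>2) (W\<^sup>2) (- 1 - int j) = W ^ (2 * j + 2) * q ^ (j * (j + 1))"
    unfolding W3 jj .
  show ?thesis
    unfolding 1 2 distrib_right[symmetric] cube_root_power(2)[OF W] by (simp only: mult_ac)
qed

text \<open>j (j + 1) / 2 + 5 j (j - 1) / 2 = j (3 j - 2), a generalised octagonal number.\<close>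

lemma theta_term_X_X5:
  "theta_term q (q ^ 5) j = q ^ nat (j * (3 * j - 2))" for q :: "'a::comm_ring_1"
proof -
  obtain s where s: "j * (j - 1) = 2 * s"
    by (rule evenE[of "j * (j - 1)"]) auto
  have t: "j * (j + 1) = 2 * (s + j)" "j * (3 * j - 2) = (s + j) + 5 * s"
    using s by (simp_all add: algebra_simps)
  have "0 \<le> j * (j + 1)" "0 \<le> j * (j - 1)"
    unfolding zero_le_mult_iff by presburger+
  then have "0 \<le> s + j" "0 \<le> s" unfolding t(1) s by simp_all
  then have "nat (j * (3 * j - 2)) = nat (s + j) + 5 * nat s"
    unfolding t by (subst nat_add_distrib) (simp_all add: nat_mult_distrib)
  then show ?thesis
    unfolding theta_term_def t(1) s by (simp add: power_add power_mult)
qed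


section \<open>Extraction of coefficients\<close>

lemma p_neg: "x < 0 \<Longrightarrow> p x = 0"
  by (auto simp: p_def elim!: Nats_cases)

lemma fps_agree_parts_gf:
  fixes f g :: "'a::comm_ring_1 fps"
  assumes "fps_agree N (qfac (fps_X ^ d) m * f) g" "d > 0"
  shows "fps_agree N f (parts_gf {1..m} d * g)"
proof -
  have "qfac (fps_X ^ d) m = (\<Prod>k\<in>{1..m}. 1 - fps_X ^ (d * k) :: 'a fps)"
    by (simp add: qfac_def power_mult)
  then have "parts_gf {1..m} d * qfac (fps_X ^ d) m = (1 :: 'a fps)"
    using parts_gf_prod[of d "{1..m}"] assms(2) by simp
  then have "f = parts_gf {1..m} d * (qfac (fps_X ^ d) m * f)"
    by (simp flip: mult.assoc)
  also have "fps_agree N \<dots> (parts_gf {1..m} d * g)"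
    by (intro fps_agree_mult fps_agree_refl assms(1))
  finally show ?thesis .
qed

text \<open>For e > n both sides are zero, the right one because \<open>p\<close> vanishes at
  negative arguments.\<close>

lemma parts_gf_mult_nth:
  assumes "d > 0" "n \<le> m"
  shows "fps_nth (parts_gf {1..m} d * fps_X ^ e) n = (of_nat (p ((real n - real e) / real d)) :: 'a::comm_ring_1)"
proof (cases "n < e")
  case True
  then have "(real n - real e) / real d < 0" using assms(1) by (simp add: divide_neg_pos)
  then show ?thesis using True by (simp add: fps_X_power_mult_right_nth p_neg)
next
  case False
  then show ?thesis
    using parts_gf_nth[of d "n - e" m, where 'a='a] assms
    by (simp add: fps_X_power_mult_right_nth of_nat_diff)
qed

lemma Q\<^sub>2_eq_octagonal_sum:
  "of_nat (Q\<^sub>2 n) = (\<Sum>j\<in>{-int (2*n+2)..int (2*n+2)}.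
     of_nat (p ((real n - real_of_int j * (3 * real_of_int j - 2)) / 3)) :: complex)"
proof -
  \<comment> \<open>\<open>theta_agree\<close> at precision \<open>Suc n\<close> asks for m >= 2 (n
    + 1).\<close>
  define m where "m = 2 * n + 2"
  let ?X = "fps_X :: complex fps"
  let ?T = "\<Sum>j\<in>{-int m..int m}. ?X ^ nat (j * (3 * j - 2))"
  let ?Q = "\<Prod>k\<in>Q\<^sub>2_parts (6 * m). 1 + ?X ^ k"
  have X6: "?X * ?X ^ 5 = ?X ^ 6" by (simp flip: power_Suc)
  \<comment> \<open>By \<open>qfac_square\<close> the new factor absorbs the product over multiples
    of 3 and becomes \<open>qfac\<close> at X^6.\<close>
  have "qfac (?X ^ 3) (2 * m) * ?Q = qfac ((?X ^ 3)\<^sup>2) (2 * m) * (\<Prod>k<m. (1 + ?X * (?X ^ 6) ^ k) * (1 + ?X ^ 5 * (?X ^ 6) ^ k))"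
    unfolding Q\<^sub>2_prod_mod_3 qfac_square[symmetric] by (simp only: mult_ac)
  also have "(?X ^ 3)\<^sup>2 = ?X ^ 6" by (simp flip: power_mult)
  also have "fps_agree (Suc n) (qfac (?X ^ 6) (2 * m) * (\<Prod>k<m. (1 + ?X * (?X ^ 6) ^ k) * (1 + ?X ^ 5 * (?X ^ 6) ^ k))) ?T"
    using theta_agree[of ?X "?X ^ 5" "Suc n" "2 * m" m] unfolding theta_term_X_X5 X6
    by (simp add: m_def)
  finally have "fps_agree (Suc n) (qfac (?X ^ 3) (2 * m) * ?Q) ?T" .
  then have "fps_agree (Suc n) ?Q (parts_gf {1..2 * m} 3 * ?T)"
    by (rule fps_agree_parts_gf) simp
  then have "fps_nth ?Q n = fps_nth (parts_gf {1..2 * m} 3 * ?T) n"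
    by (simp add: fps_agree_def)
  also have "fps_nth ?Q n = of_nat (Q\<^sub>2 n)"
    by (rule Q\<^sub>2_gf_nth) (simp add: m_def)
  also have "fps_nth (parts_gf {1..2 * m} 3 * ?T) n
    = (\<Sum>j\<in>{-int m..int m}. of_nat (p ((real n - real (nat (j * (3 * j - 2)))) / real 3)))"
    unfolding sum_distrib_left fps_sum_nth
    by (intro sum.cong refl parts_gf_mult_nth) (simp_all add: m_def)
  also have "\<dots> = (\<Sum>j\<in>{-int m..int m}. of_nat (p ((real n - real_of_int j * (3 * real_of_int j - 2)) / 3)))"
  proof (intro sum.cong refl)
    fix j :: int
    have "0 \<le> j * (3 * j - 2)" unfolding zero_le_mult_iff by presburger
    then have "real (nat (j * (3 * j - 2))) = real_of_int (j * (3 * j - 2))" by simp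
    then show "of_nat (p ((real n - real (nat (j * (3 * j - 2)))) / real 3))
      = (of_nat (p ((real n - real_of_int j * (3 * real_of_int j - 2)) / 3)) :: complex)" by simp
  qed
  finally show ?thesis unfolding m_def .
qed

lemma fps_agree_one_plus:
  fixes f :: "'a::comm_ring_1 fps"
  assumes "N \<le> k"
  shows "fps_agree N (1 + f * fps_X ^ k) 1"
proof -
  have "fps_agree N (1 + f * fps_X ^ k) (1 + f * 0)"
    by (intro fps_agree_add fps_agree_mult fps_agree_refl fps_agree_power_0 assms) simp
  then show ?thesis by simp
qed

text \<open>Here a b = X^2 because W^3 = 1. Pairing leaves only the index 3 m, whose term vanishes
  modulo X^N.\<close>

lemma theta_agree_cube_root:
  fixes W :: "'a::field fps"
  assumes W: "1 + W + W\<^sup>2 = 0" and m: "N < m"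
  defines "X \<equiv> fps_X"
  shows "fps_agree N (qfac (X\<^sup>2) (6 * m) * (\<Prod>k<3*m. (1 + W * X\<^sup>2 * (X\<^sup>2) ^ k) * (1 + W\<^sup>2 * (X\<^sup>2) ^ k)))
    ((1 + W\<^sup>2) * (\<Sum>j<3*m. of_int (\<rho> (int j)) * X ^ (j * (j + 1))))"
proof -
  let ?t = "theta_term (W * X\<^sup>2) (W\<^sup>2)"
  have W3: "W ^ 3 = 1" by (rule cube_root_power(1)[OF W])
  then have "W \<noteq> 0" by auto
  have ab: "W * X\<^sup>2 * W\<^sup>2 = X\<^sup>2"
    using W3 by (simp add: power3_eq_cube power2_eq_square mult_ac)
  have "fps_agree N (qfac (X\<^sup>2) (6 * m) * (\<Prod>k<3*m. (1 + W * X\<^sup>2 * (X\<^sup>2) ^ k) * (1 + W\<^sup>2 * (X\<^sup>2) ^ k)))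
    (\<Sum>j\<in>{-int (3*m)..int (3*m)}. ?t j)"
    using theta_agree[of "W * X\<^sup>2" "W\<^sup>2" N "6 * m" "3 * m"] \<open>W \<noteq> 0\<close> m unfolding ab
    by (simp add: X_def)
  also have "(\<Sum>j\<in>{-int (3*m)..int (3*m)}. ?t j)
    = (1 + W\<^sup>2) * (\<Sum>j<3*m. of_int (\<rho> (int j)) * X ^ (j * (j + 1))) + ?t (int (3 * m))"
    unfolding sum_pair_neg theta_term_cube_root[OF W] sum_distrib_left ..
  also have "fps_agree N \<dots> ((1 + W\<^sup>2) * (\<Sum>j<3*m. of_int (\<rho> (int j)) * X ^ (j * (j + 1))) + 0)"
  proof (intro fps_agree_add fps_agree_refl theta_term_agree_0)
    show "fps_nth (W * X\<^sup>2 * W\<^sup>2) 0 = 0" unfolding ab by (simp add: X_def)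
  qed (use m in simp)
  finally show ?thesis by simp
qed

text \<open>The congruence is shown after multiplication by \<open>?z\<close> and \<open>?E\<close>,
  which have nonzero constant coefficients. \<open>Q\<^sub>2_prod_mod_2\<close> and
  \<open>cube_root_prod\<close> then link the two sides through \<open>?D\<close>.\<close>

lemma Q\<^sub>2_prod_agree_pronic:
  fixes w :: complex
  assumes w: "1 + w + w\<^sup>2 = 0" and m: "N < m"
  defines "X \<equiv> (fps_X :: complex fps)"
  shows "fps_agree N (qfac X (6 * m) * (\<Prod>k\<in>Q\<^sub>2_parts (6 * m). 1 + X ^ k))
    (\<Sum>j<3*m. of_int (\<rho> (int j)) * X ^ (j * (j + 1)))"
proof -
  define W where "W = fps_const w"
  have W: "1 + W + W\<^sup>2 = 0"
    unfolding W_def using w by (simp flip: fps_const_1_eq_1)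
  let ?Q = "\<Prod>k\<in>Q\<^sub>2_parts (6 * m). 1 + X ^ k"
  let ?E = "\<Prod>k=1..3*m. 1 + X ^ (2 * k)"
  let ?D = "\<lambda>l. \<Prod>k=1..l. 1 + X ^ (6 * k)"
  let ?S = "\<Sum>j<3*m. of_int (\<rho> (int j)) * X ^ (j * (j + 1))"
  let ?P = "\<Prod>k<3*m. (1 + W * X\<^sup>2 * (X\<^sup>2) ^ k) * (1 + W\<^sup>2 * (X\<^sup>2) ^ k)"
  let ?z = "1 + W\<^sup>2"
  let ?F = "qfac (X\<^sup>2) (6 * m)"
  have Q: "qfac X (6 * m) * ?Q * ?E = ?F * ?D m"
    unfolding mult.assoc Q\<^sub>2_prod_mod_2 unfolding mult.assoc[symmetric] qfac_square ..
  \<comment> \<open>The extra factor of \<open>cube_root_prod\<close> has exponent 6 m > N and is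
    congruent to 1.\<close>
  have "fps_agree N (?P * ?E * 1) (?P * ?E * (1 + W\<^sup>2 * X ^ (2 * (3 * m))))"
    unfolding X_def by (intro fps_agree_mult fps_agree_refl fps_agree_sym[OF fps_agree_one_plus]) (use m in simp)
  also have "\<dots> = ?z * ?D (3 * m)" by (rule cube_root_prod[OF W])
  \<comment> \<open>The factors from m + 1 to 3 m are congruent to 1.\<close>
  also have "fps_agree N \<dots> (?z * ?D m)"
  proof (intro fps_agree_mult fps_agree_refl fps_agree_prod_stable)
    show "fps_agree N (1 + X ^ (6 * k)) 1" if "N < k" for k
      using fps_agree_one_plus[of N "6 * k" 1] that by (simp add: X_def)
  qed (use m in auto)
  finally have PE: "fps_agree N (?P * ?E) (?z * ?D m)" by simp
  have "fps_agree N (?z * ?E * (qfac X (6 * m) * ?Q)) (?F * (?P * ?E))"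
  proof -
    have "?z * ?E * (qfac X (6 * m) * ?Q) = ?z * (qfac X (6 * m) * ?Q * ?E)" by (simp only: mult_ac)
    also have "\<dots> = ?F * (?z * ?D m)" unfolding Q by (simp only: mult_ac)
    also have "fps_agree N \<dots> (?F * (?P * ?E))"
      by (intro fps_agree_mult fps_agree_refl fps_agree_sym[OF PE])
    finally show ?thesis .
  qed
  also have "?F * (?P * ?E) = ?F * ?P * ?E" by (simp only: mult_ac)
  also have "fps_agree N \<dots> (?z * ?S * ?E)"
    unfolding X_def by (intro fps_agree_mult fps_agree_refl theta_agree_cube_root W m)
  also have "?z * ?S * ?E = ?z * ?E * ?S" by (simp only: mult_ac)
  finally show ?thesis
  proof (rule fps_agree_cancel)
    have "w \<noteq> 0" using w by auto
    then have "1 + w\<^sup>2 \<noteq> 0" using w by (metis add.commute add.left_commute add_cancel_right_right)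
    moreover have "fps_nth ?z 0 = 1 + w\<^sup>2" by (simp add: W_def fps_const_power)
    moreover have "fps_nth (\<Prod>k=1..l. 1 + X ^ (2 * k)) 0 = 1" for l
      by (induction l) (simp_all add: X_def fps_X_power_iff)
    ultimately show "fps_nth (?z * ?E) 0 \<noteq> 0" by simp
  qed
qed

lemma Q\<^sub>2_eq_pronic_sum:
  "of_nat (Q\<^sub>2 n) = (\<Sum>j<3*(n+2). of_int (\<rho> (int j)) * of_nat (p (real n - real j * (real j + 1))) :: complex)"
proof -
  define m where "m = n + 2"
  let ?X = "fps_X :: complex fps"
  let ?T = "\<Sum>j<3*m. of_int (\<rho> (int j)) * ?X ^ (j * (j + 1))"
  let ?Q = "\<Prod>k\<in>Q\<^sub>2_parts (6 * m). 1 + ?X ^ k"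
  \<comment> \<open>The primitive cube root of unity exp(2 pi i / 3).\<close>
  define w where "w = Complex (- 1 / 2) (sqrt 3 / 2)"
  have w: "1 + w + w\<^sup>2 = 0"
    by (simp add: w_def complex_eq_iff power2_eq_square)
  have "fps_agree (Suc n) (qfac (?X ^ 1) (6 * m) * ?Q) ?T"
    using Q\<^sub>2_prod_agree_pronic[OF w, of "Suc n" m] by (simp add: m_def)
  then have "fps_agree (Suc n) ?Q (parts_gf {1..6 * m} 1 * ?T)"
    by (rule fps_agree_parts_gf) simp
  then have "fps_nth ?Q n = fps_nth (parts_gf {1..6 * m} 1 * ?T) n"
    by (simp add: fps_agree_def)
  also have "fps_nth ?Q n = of_nat (Q\<^sub>2 n)"
    by (rule Q\<^sub>2_gf_nth) (simp add: m_def)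
  also have "fps_nth (parts_gf {1..6 * m} 1 * ?T) n
    = (\<Sum>j<3*m. of_int (\<rho> (int j)) * of_nat (p (real n - real j * (real j + 1))))"
    unfolding sum_distrib_left fps_sum_nth
  proof (intro sum.cong refl)
    fix j
    have eq: "parts_gf {1..6 * m} 1 * (of_int (\<rho> (int j)) * ?X ^ (j * (j + 1)))
      = fps_const (of_int (\<rho> (int j))) * (parts_gf {1..6 * m} 1 * ?X ^ (j * (j + 1)))"
      unfolding fps_of_int by (simp only: mult_ac)
    show "fps_nth (parts_gf {1..6 * m} 1 * (of_int (\<rho> (int j)) * ?X ^ (j * (j + 1)))) n
      = of_int (\<rho> (int j)) * of_nat (p (real n - real j * (real j + 1)))"
      using parts_gf_mult_nth[of 1 n "6 * m" "j * (j + 1)", where 'a=complex]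
      unfolding eq fps_mult_left_const_nth by (simp add: m_def algebra_simps)
  qed
  finally show ?thesis unfolding m_def .
qed

theorem theorem1p12:
  fixes n :: nat
  shows
    "((\<lambda>j::nat. real_of_int (\<rho> (int j)) * real (p (real n - real j * (real j + 1))))
        has_sum real (Q\<^sub>2 n)) UNIV
    \<and>
    ((\<lambda>j::int. real (p ((real n - real_of_int j * (3 * real_of_int j - 2)) / 3)))
        has_sum real (Q\<^sub>2 n)) UNIV"
proof (intro conjI has_sum_finite_neutralI)
  \<comment> \<open>Both sums have finite support: outside the ranges of the finite identities the
    argument of \<open>p\<close> is negative.\<close>
  show "real_of_int (\<rho> (int j)) * real (p (real n - real j * (real j + 1))) = 0"
    if "j \<in> UNIV - {..<3*(n+2)}" for j
  proof -
    have "real n < real j * 1" using that by simp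
    also have "\<dots> \<le> real j * (real j + 1)" by (intro mult_left_mono) auto
    finally show ?thesis by (simp add: p_neg)
  qed
  \<comment> \<open>The identity was proved over the complex numbers, where a cube root of unity
    exists; injectivity of \<open>of_real\<close> returns it to the reals.\<close>
  have "of_real (real (Q\<^sub>2 n)) = (of_real (\<Sum>j<3*(n+2). real_of_int (\<rho> (int j)) * real (p (real n - real j * (real j + 1)))) :: complex)"
    using Q\<^sub>2_eq_pronic_sum[of n] by simp
  then show "real (Q\<^sub>2 n) = (\<Sum>j<3*(n+2). real_of_int (\<rho> (int j)) * real (p (real n - real j * (real j + 1))))"
    by (simp only: of_real_eq_iff)
  show "real (p ((real n - real_of_int j * (3 * real_of_int j - 2)) / 3)) = 0"
    if "j \<in> UNIV - {-int (2*n+2)..int (2*n+2)}" for j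
  proof -
    \<comment> \<open>An integer j never makes 3 j - 2 zero, so j (3 j - 2) is at least |j|.\<close>
    have "int n < \<bar>j\<bar> * 1" using that by auto
    also have "1 \<le> \<bar>3 * j - 2\<bar>" by presburger
    then have "\<bar>j\<bar> * 1 \<le> \<bar>j\<bar> * \<bar>3 * j - 2\<bar>" by (rule mult_left_mono) simp
    also have "\<dots> = j * (3 * j - 2)"
    proof -
      have "0 \<le> j * (3 * j - 2)" unfolding zero_le_mult_iff by presburger
      then show ?thesis by (simp flip: abs_mult)
    qed
    finally have "real_of_int (int n) < real_of_int (j * (3 * j - 2))" by (simp only: of_int_less_iff)
    then show ?thesis by (simp add: p_neg)
  qed
  have "of_real (real (Q\<^sub>2 n)) = (of_real (\<Sum>j\<in>{-int (2*n+2)..int (2*n+2)}.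
      real (p ((real n - real_of_int j * (3 * real_of_int j - 2)) / 3))) :: complex)"
    using Q\<^sub>2_eq_octagonal_sum[of n] by simp
  then show "real (Q\<^sub>2 n) = (\<Sum>j\<in>{-int (2*n+2)..int (2*n+2)}.
      real (p ((real n - real_of_int j * (3 * real_of_int j - 2)) / 3)))"
    by (simp only: of_real_eq_iff)
qed auto

end
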